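(* There is a bijection between the set of threshold graphs on the vertex set $[n]$ and the set of normal simply barred permutations of $[n]$ whose central block has at least two elements. The bijection sends vertices of equal degree to vertices in the same block: if the graph $([n],E)$ corresponds to $(w,B)$, then vertices of equal degree in $([n],E)$ are in the same block of $(w,B)$.
   Context: $[n]=\{1,\dots,n\}$. A simple graph is threshold if it has no induced subgraph isomorphic to $2K_2$ (two disjoint edges), the path with three edges on four vertices, or the 4-cycle $C_4$. A simply barred permutation of $[n]$ is a pair $(w,B)$ with $w=w_1\cdots w_n$ a permutation of $[n]$ and $B\subseteq[n]$. Placing a bar after $w_i$ for each $i\in B$ divides $w$ into $|B|+1$ consecutive blocks; all blocks are nonempty except possibly the last one, which is empty iff $n\in B$. $(w,B)$ is normal if, whenever $i<j$ belong to the same block, $w^{-1}(i)<w^{-1}(j)$ (i.e. the letters in each block are increasing). The central block of $(w,B)$ is its $k$-th block (from the left) with $k=\left\lceil\frac{|B|+1}{2}\right\rceil$.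
   Formalization: The hypothesis n ≥ 2 is added: for n = 0 and n = 1 there is exactly one threshold graph on [n], but no block can have two elements, so no such bijection exists. *)

theory Defs
  imports Complex_Main "HOL-Combinatorics.Permutations"
begin

type_synonym 'a ugraph = "'a set \<times> 'a set set"

abbreviation verts :: "'a ugraph \<Rightarrow> 'a set" where
  "verts G \<equiv> fst G"

abbreviation edges :: "'a ugraph \<Rightarrow> 'a set set" where
  "edges G \<equiv> snd G"

definition simple_graph :: "'a ugraph \<Rightarrow> bool" where
  "simple_graph G \<longleftrightarrow> finite (verts G) \<and> (\<forall>e\<in>edges G. e \<subseteq> verts G \<and> card e = 2)"

definition degree :: "'a ugraph \<Rightarrow> 'a \<Rightarrow> nat" where
  "degree G v = card {e \<in> edges G. v \<in> e}"

definition induced_subgraph :: "'a ugraph \<Rightarrow> 'a set \<Rightarrow> 'a ugraph" where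
  "induced_subgraph G S = (S, {e \<in> edges G. e \<subseteq> S})"

definition isomorphic :: "'a ugraph \<Rightarrow> 'b ugraph \<Rightarrow> bool" where
  "isomorphic G H \<longleftrightarrow>
    (\<exists>f. bij_betw f (verts G) (verts H) \<and>
         (\<forall>u\<in>verts G. \<forall>v\<in>verts G. {u, v} \<in> edges G \<longleftrightarrow> {f u, f v} \<in> edges H))"

definition two_K2 :: "nat ugraph" where
  "two_K2 = ({0, 1, 2, 3}, {{0, 1}, {2, 3}})"

definition path_P4 :: "nat ugraph" where
  "path_P4 = ({0, 1, 2, 3}, {{0, 1}, {1, 2}, {2, 3}})"

definition cycle_C4 :: "nat ugraph" where
  "cycle_C4 = ({0, 1, 2, 3}, {{0, 1}, {1, 2}, {2, 3}, {3, 0}})"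

definition threshold :: "'a ugraph \<Rightarrow> bool" where
  "threshold G \<longleftrightarrow> simple_graph G \<and>
    \<not> (\<exists>S \<subseteq> verts G.
         isomorphic (induced_subgraph G S) two_K2 \<or>
         isomorphic (induced_subgraph G S) path_P4 \<or>
         isomorphic (induced_subgraph G S) cycle_C4)"

definition threshold_graphs :: "nat \<Rightarrow> nat ugraph set" where
  "threshold_graphs n = {G. verts G = {1..n} \<and> threshold G}"

text \<open>
  The word \<open>w\<^sub>1 \<dots> w\<^sub>n\<close> is the function \<open>i \<mapsto> w\<^sub>i\<close>, the identity outside \<open>{1..n}\<close>,
  so that distinct pairs are distinct barred permutations.
\<close>

type_synonym barred_perm = "(nat \<Rightarrow> nat) \<times> nat set"

definition simply_barred :: "nat \<Rightarrow> barred_perm \<Rightarrow> bool" where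
  "simply_barred n = (\<lambda>(w, B). w permutes {1..n} \<and> B \<subseteq> {1..n})"

text \<open>
  A bar \<open>b \<in> B\<close> stands immediately after position \<open>b\<close>, hence to the left of position \<open>i\<close>
  iff \<open>b < i\<close>. Position \<open>i\<close> is therefore in the \<open>k\<close>-th block, counting from 1, iff exactly
  \<open>k - 1\<close> bars stand to its left. Blocks are taken as sets of letters; the one numbered
  \<open>card B + 1\<close> is empty iff \<open>n \<in> B\<close> (for \<open>n > 0\<close>).
\<close>

definition block :: "nat \<Rightarrow> barred_perm \<Rightarrow> nat \<Rightarrow> nat set" where
  "block n = (\<lambda>(w, B) k. w ` {i \<in> {1..n}. card {b \<in> B. b < i} + 1 = k})"

definition same_block :: "nat \<Rightarrow> barred_perm \<Rightarrow> nat \<Rightarrow> nat \<Rightarrow> bool" where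
  "same_block n p x y \<longleftrightarrow> (\<exists>k \<in> {1..card (snd p) + 1}. x \<in> block n p k \<and> y \<in> block n p k)"

definition normal :: "nat \<Rightarrow> barred_perm \<Rightarrow> bool" where
  "normal n p \<longleftrightarrow> (\<forall>i j. i < j \<and> same_block n p i j \<longrightarrow> inv (fst p) i < inv (fst p) j)"

definition central_block :: "nat \<Rightarrow> barred_perm \<Rightarrow> nat set" where
  "central_block n p = block n p (nat \<lceil>real (card (snd p) + 1) / 2\<rceil>)"

definition central_barred_perms :: "nat \<Rightarrow> barred_perm set" where
  "central_barred_perms n =
    {p. simply_barred n p \<and> normal n p \<and> card (central_block n p) \<ge> 2}"

end

theory Submission imports Defs begin

text \<open>
  Number the blocks of a barred permutation \<open>1, \<dots>, m\<close> and join two vertices iff their block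
  indices sum to at most \<open>m\<close>. This gives a threshold graph, and because the central block has at
  least two elements, the degree strictly decreases with the block index. Hence the blocks are
  exactly the degree classes, the last block is the (possibly empty) set of isolated vertices,
  and the graph determines the barred permutation. Conversely, a threshold graph has an isolated
  or a dominating vertex, and deleting it yields such a block structure by induction: an isolated
  vertex goes back into the last block; a dominating vertex goes into the first block if the
  last one is empty, and otherwise forms a new first block, with a new empty block at the end.
\<close>

section \<open>Forbidden subgraphs as alternating four-cycles\<close>

text \<open>
  The cycle \<open>a - b - d - c - a\<close> alternates between edges and non-edges; the status of the two
  diagonals \<open>{a, d}\<close> and \<open>{b, c}\<close> decides which of the three forbidden graphs is induced.
\<close>

definition alternating_cycle_in :: "'a set \<Rightarrow> ('a \<Rightarrow> 'a \<Rightarrow> bool) \<Rightarrow> bool" where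
  "alternating_cycle_in V R \<longleftrightarrow>
    (\<exists>a\<in>V. \<exists>b\<in>V. \<exists>c\<in>V. \<exists>d\<in>V. distinct [a, b, c, d] \<and> R a b \<and> R c d \<and> \<not> R a c \<and> \<not> R b d)"

lemma alternating_cycle_in_mono:
  "alternating_cycle_in W R \<Longrightarrow> W \<subseteq> V \<Longrightarrow> alternating_cycle_in V R"
  unfolding alternating_cycle_in_def by (meson subsetD)

text \<open>\<open>isomorphic\<close> also compares pairs with \<open>u = v\<close>, where
  \<open>{u, v}\<close> is a singleton. The two loop-freeness hypotheses settle those, and symmetry
  of unordered pairs reduces the rest to six cases.\<close>

lemma isomorphic_induced_quadruple:
  assumes "distinct [p, q, r, s]"
    and "verts H = {0, 1, 2, 3 :: nat}"
    and "\<And>x y. {x, y} \<in> edges H \<Longrightarrow> x \<noteq> y"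
    and "\<And>x. {x, x} \<notin> E"
    and "{p, q} \<in> E \<longleftrightarrow> {0, 1} \<in> edges H" "{p, r} \<in> E \<longleftrightarrow> {0, 2} \<in> edges H"
      "{p, s} \<in> E \<longleftrightarrow> {0, 3} \<in> edges H" "{q, r} \<in> E \<longleftrightarrow> {1, 2} \<in> edges H"
      "{q, s} \<in> E \<longleftrightarrow> {1, 3} \<in> edges H" "{r, s} \<in> E \<longleftrightarrow> {2, 3} \<in> edges H"
  shows "isomorphic (induced_subgraph (V, E) {p, q, r, s}) H"
proof -
  define f :: "_ \<Rightarrow> nat" where
    "f = (\<lambda>x. if x = p then 0 else if x = q then 1 else if x = r then 2 else 3)"
  have f: "f p = 0" "f q = 1" "f r = 2" "f s = 3"
    using assms(1) by (auto simp: f_def)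
  define S where "S = {p, q, r, s}"
  have loop: "{k, k} \<notin> edges H" for k
    using assms(3)[of k k] by blast
  have "bij_betw f S {0, 1, 2, 3}"
    unfolding S_def bij_betw_def inj_on_def using f by auto
  moreover have "\<forall>u\<in>S. \<forall>v\<in>S. {u, v} \<in> E \<longleftrightarrow> {f u, f v} \<in> edges H"
    unfolding S_def using f assms(5-) loop assms(4) by (simp add: insert_commute)
  ultimately have "isomorphic (induced_subgraph (V, E) S) H"
    unfolding isomorphic_def induced_subgraph_def using assms(2) by (intro exI[of _ f]) simp
  then show ?thesis by (simp only: S_def)
qed

text \<open>All three forbidden graphs contain the edges 01 and 23 and lack 02 and 13, so the
  preimages of 0, 1, 2, 3 serve as \<open>a\<close>, \<open>b\<close>, \<open>c\<close>,
  \<open>d\<close>.\<close>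

lemma isomorphic_alternating_cycle:
  assumes "isomorphic (induced_subgraph (V, E) S) H"
    and "verts H = {0, 1, 2, 3 :: nat}"
    and "{0, 1} \<in> edges H" "{2, 3} \<in> edges H" "{0, 2} \<notin> edges H" "{1, 3} \<notin> edges H"
    and "S \<subseteq> V"
  shows "alternating_cycle_in V (\<lambda>u v. {u, v} \<in> E)"
proof -
  obtain f where bij: "bij_betw f S {0, 1, 2, 3}"
    and f: "\<And>u v. u \<in> S \<Longrightarrow> v \<in> S \<Longrightarrow> {u, v} \<in> E \<longleftrightarrow> {f u, f v} \<in> edges H"
    using assms(1,2) unfolding isomorphic_def induced_subgraph_def by auto
  have im: "f ` S = {0, 1, 2, 3}" using bij by (simp add: bij_betw_def)
  have pre: "\<exists>x\<in>S. f x = k" if "k \<in> {0, 1, 2, 3}" for k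
    using that unfolding im[symmetric] by blast
  obtain a b c d where S: "a \<in> S" "b \<in> S" "c \<in> S" "d \<in> S"
    and v: "f a = 0" "f b = 1" "f c = 2" "f d = 3"
    using pre[of 0] pre[of 1] pre[of 2] pre[of 3] by auto
  have "distinct [a, b, c, d]" using v by auto
  moreover have "{a, b} \<in> E" "{c, d} \<in> E" "{a, c} \<notin> E" "{b, d} \<notin> E"
    using S v f assms(3-6) by simp_all
  ultimately show ?thesis
    unfolding alternating_cycle_in_def using S assms(7) by blast
qed

lemma threshold_iff_no_alternating_cycle:
  assumes "simple_graph (V, E)"
  shows "threshold (V, E) \<longleftrightarrow> \<not> alternating_cycle_in V (\<lambda>u v. {u, v} \<in> E)"
proof
  assume th: "threshold (V, E)"
  have loop: "{x, x} \<notin> E" for x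
    using assms unfolding simple_graph_def by fastforce
  note defs = two_K2_def path_P4_def cycle_C4_def
  show "\<not> alternating_cycle_in V (\<lambda>u v. {u, v} \<in> E)"
  proof
    assume "alternating_cycle_in V (\<lambda>u v. {u, v} \<in> E)"
    then obtain a b c d where V: "{a, b, c, d} \<subseteq> V" and dist: "distinct [a, b, c, d]"
      and e: "{a, b} \<in> E" "{c, d} \<in> E" "{a, c} \<notin> E" "{b, d} \<notin> E"
      unfolding alternating_cycle_in_def by auto
    \<comment> \<open>Exchanging \<open>a\<close> with \<open>b\<close> and \<open>c\<close> with
      \<open>d\<close> preserves the alternating cycle and swaps its diagonals. Thus the case
      \<open>ad\<close> becomes the path b - a - d - c.\<close>
    have V': "{b, a, d, c} \<subseteq> V" using V by auto
    have dist': "distinct [b, a, d, c]" using dist by auto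
    have e': "{b, a} \<in> E" "{d, c} \<in> E" "{c, a} \<notin> E" "{d, b} \<notin> E"
      using e by (simp_all add: insert_commute)
    have sym: "{d, a} = {a, d}" "{c, b} = {b, c}" by auto
    consider (none) "{a, d} \<notin> E" "{b, c} \<notin> E" | (bc) "{a, d} \<notin> E" "{b, c} \<in> E"
      | (ad) "{a, d} \<in> E" "{b, c} \<notin> E" | (both) "{a, d} \<in> E" "{b, c} \<in> E"
      by blast
    then show False
    proof cases
      case none
      have "isomorphic (induced_subgraph (V, E) {a, b, c, d}) two_K2"
        by (rule isomorphic_induced_quadruple[OF dist])
          (use none e loop in \<open>auto simp: defs doubleton_eq_iff\<close>)
      then show False using th V unfolding threshold_def by auto
    next
      case bc
      have "isomorphic (induced_subgraph (V, E) {a, b, c, d}) path_P4"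
        by (rule isomorphic_induced_quadruple[OF dist])
          (use bc e loop in \<open>auto simp: defs doubleton_eq_iff\<close>)
      then show False using th V unfolding threshold_def by auto
    next
      case ad
      have "isomorphic (induced_subgraph (V, E) {b, a, d, c}) path_P4"
        by (rule isomorphic_induced_quadruple[OF dist'])
          (use ad e e' loop in \<open>auto simp: defs doubleton_eq_iff\<close>)
      then show False using th V' unfolding threshold_def by auto
    next
      case both
      have "isomorphic (induced_subgraph (V, E) {a, b, c, d}) cycle_C4"
        by (rule isomorphic_induced_quadruple[OF dist])
          (use both e loop in \<open>auto simp: defs doubleton_eq_iff\<close>)
      then show False using th V unfolding threshold_def by auto
    qed
  qed
next
  assume no: "\<not> alternating_cycle_in V (\<lambda>u v. {u, v} \<in> E)"
  have "\<not> isomorphic (induced_subgraph (V, E) S) H"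
    if "S \<subseteq> V" "H \<in> {two_K2, path_P4, cycle_C4}" for S H
  proof
    assume "isomorphic (induced_subgraph (V, E) S) H"
    from isomorphic_alternating_cycle[OF this _ _ _ _ _ that(1)] that(2) no show False
      by (auto simp: two_K2_def path_P4_def cycle_C4_def doubleton_eq_iff)
  qed
  then show "threshold (V, E)"
    unfolding threshold_def using assms by auto
qed

section \<open>Level graphs\<close>

text \<open>Only level \<open>m\<close> may be empty, like the last block. For
  \<open>m = card B + 1\<close> blocks, \<open>(m + 1) div 2\<close> is the rounded-up half that
  numbers the central one.\<close>

definition central_partition :: "'a set \<Rightarrow> nat \<Rightarrow> ('a \<Rightarrow> nat) \<Rightarrow> bool" where
  "central_partition V m \<beta> \<longleftrightarrow>
    \<beta> ` V \<subseteq> {1..m} \<and> {1..<m} \<subseteq> \<beta> ` V \<and> 2 \<le> card {x \<in> V. \<beta> x = (m + 1) div 2}"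

definition level_graph :: "'a set \<Rightarrow> nat \<Rightarrow> ('a \<Rightarrow> nat) \<Rightarrow> 'a ugraph" where
  "level_graph V m \<beta> = (V, {{u, v} | u v. u \<in> V \<and> v \<in> V \<and> u \<noteq> v \<and> \<beta> u + \<beta> v \<le> m})"

lemma verts_level_graph [simp]: "verts (level_graph V m \<beta>) = V"
  by (simp add: level_graph_def)

lemma level_graph_cong:
  assumes "\<And>v. v \<in> V \<Longrightarrow> \<beta> v = \<beta>' v"
  shows "level_graph V m \<beta> = level_graph V m \<beta>'"
  unfolding level_graph_def
  by (intro arg_cong2[where f = Pair] refl Collect_cong ex_cong1 conj_cong) (simp add: assms)

lemma edges_level_graph_iff:
  "{u, v} \<in> edges (level_graph V m \<beta>) \<longleftrightarrow> u \<in> V \<and> v \<in> V \<and> u \<noteq> v \<and> \<beta> u + \<beta> v \<le> m"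
  by (auto simp: level_graph_def doubleton_eq_iff)

lemma simple_graph_level_graph: "finite V \<Longrightarrow> simple_graph (level_graph V m \<beta>)"
  by (auto simp: simple_graph_def level_graph_def)

text \<open>On an alternating cycle, the two edges bound the sum of all four levels by
  \<open>2 * m\<close>, while the two non-edges force the same sum above
  \<open>2 * m\<close>.\<close>

lemma threshold_level_graph:
  assumes "finite V"
  shows "threshold (level_graph V m \<beta>)"
proof -
  obtain E where G: "level_graph V m \<beta> = (V, E)" by (simp add: level_graph_def)
  have E: "{u, v} \<in> E \<longleftrightarrow> u \<in> V \<and> v \<in> V \<and> u \<noteq> v \<and> \<beta> u + \<beta> v \<le> m" for u v
    using edges_level_graph_iff[of u v V m \<beta>] by (simp add: G)
  have "\<not> alternating_cycle_in V (\<lambda>u v. {u, v} \<in> E)"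
    unfolding alternating_cycle_in_def E by auto
  then show ?thesis
    using threshold_iff_no_alternating_cycle simple_graph_level_graph[OF assms, of m \<beta>] G
    by metis
qed

text \<open>
  The neighbours of a vertex on level \<open>i\<close> are the vertices on the levels up to \<open>m - i\<close>,
  except for the vertex itself if \<open>i \<le> m - i\<close>.
\<close>

definition level_degree :: "'a set \<Rightarrow> nat \<Rightarrow> ('a \<Rightarrow> nat) \<Rightarrow> nat \<Rightarrow> nat" where
  "level_degree V m \<beta> i = card {x \<in> V. \<beta> x \<le> m - i} - of_bool (2 * i \<le> m)"

lemma degree_level_graph:
  assumes "finite V" "v \<in> V" "\<beta> v \<le> m"
  shows "degree (level_graph V m \<beta>) v = level_degree V m \<beta> (\<beta> v)"
proof -
  let ?A = "{x \<in> V. \<beta> x \<le> m - \<beta> v}"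
  have "{e \<in> edges (level_graph V m \<beta>). v \<in> e} = (\<lambda>u. {u, v}) ` (?A - {v})"
  proof (intro set_eqI iffI)
    fix e assume "e \<in> (\<lambda>u. {u, v}) ` (?A - {v})"
    then obtain u where "u \<in> ?A" "u \<noteq> v" "e = {u, v}" by blast
    then show "e \<in> {e \<in> edges (level_graph V m \<beta>). v \<in> e}"
      using assms by (auto simp: edges_level_graph_iff)
  qed (use assms in \<open>auto simp: level_graph_def insert_commute\<close>)
  moreover have "inj_on (\<lambda>u. {u, v}) (?A - {v})"
    by (auto simp: inj_on_def doubleton_eq_iff)
  ultimately have "degree (level_graph V m \<beta>) v = card (?A - {v})"
    by (simp add: degree_def card_image)
  also have "\<dots> = level_degree V m \<beta> (\<beta> v)"
  proof (cases "v \<in> ?A")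
    case True
    then have "2 * \<beta> v \<le> m" using assms(3) by auto
    then show ?thesis using True by (simp add: level_degree_def)
  next
    case False
    then have "\<not> 2 * \<beta> v \<le> m" using assms by auto
    then show ?thesis using False by (simp add: level_degree_def)
  qed
  finally show ?thesis .
qed

text \<open>
  If the correction term drops from 1 to 0 between the levels \<open>i < j\<close>, then the central block
  lies among the levels \<open>m - j + 1, \<dots>, m - i\<close>; its two elements compensate for the drop.
\<close>

lemma level_degree_less:
  assumes "finite V" "central_partition V m \<beta>" "1 \<le> i" "i < j" "j \<le> m"
  shows "level_degree V m \<beta> j < level_degree V m \<beta> i"
proof -
  define S where "S k = card {x \<in> V. \<beta> x \<le> k}" for k
  have add: "S l + card {x \<in> V. \<beta> x = k} \<le> S h" if "l < k" "k \<le> h" for l k h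
  proof -
    have "S l + card {x \<in> V. \<beta> x = k} = card ({x \<in> V. \<beta> x \<le> l} \<union> {x \<in> V. \<beta> x = k})"
      unfolding S_def using assms(1) that by (subst card_Un_disjoint) auto
    also have "\<dots> \<le> S h"
      unfolding S_def using assms(1) that by (intro card_mono) auto
    finally show ?thesis .
  qed
  have central: "2 \<le> card {x \<in> V. \<beta> x = (m + 1) div 2}"
    using assms(2) by (simp add: central_partition_def)
  \<comment> \<open>Since \<open>1 \<le> m - i < m\<close>, this level is inhabited. It is counted
    in \<open>S (m - i)\<close> but not in \<open>S (m - j)\<close>.\<close>
  have "m - i \<in> \<beta> ` V"
    using assms(2-5) unfolding central_partition_def by auto
  then have "{x \<in> V. \<beta> x = m - i} \<noteq> {}" by auto
  then have "0 < card {x \<in> V. \<beta> x = m - i}"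
    using assms(1) by (simp add: card_gt_0_iff)
  then have one: "S (m - j) < S (m - i)"
    using add[of "m - j" "m - i" "m - i"] assms(4,5) by linarith
  \<comment> \<open>The corrections at \<open>i\<close> and \<open>j\<close> are 1 and 0 in the
    first case, both 1 in the second, and both 0 in the third.\<close>
  consider "2 * i \<le> m" "m < 2 * j" | "2 * j \<le> m" | "m < 2 * i" by linarith
  then show ?thesis
  proof cases
    case 1
    then have "S (m - j) + 2 \<le> S (m - i)"
      using add[of "m - j" "(m + 1) div 2" "m - i"] assms(5) central by linarith
    then show ?thesis
      using 1 by (simp add: level_degree_def S_def)
  next
    case 2
    \<comment> \<open>Truncated subtraction of 1 on both sides could lose strictness if
      \<open>S (m - j)\<close> were 0. It is positive because the central level is at most
      \<open>m - j\<close>.\<close>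
    have "S 0 + card {x \<in> V. \<beta> x = (m + 1) div 2} \<le> S (m - j)"
      using 2 assms by (intro add) auto
    then have "0 < S (m - j)" using central by linarith
    then show ?thesis
      using 2 one assms(4) by (auto simp: level_degree_def S_def)
  next
    case 3
    then show ?thesis
      using one assms(4) by (auto simp: level_degree_def S_def)
  qed
qed

text \<open>The value at \<open>m\<close> is the degree of the vertices in the last block, which may be empty.\<close>

lemma level_degree_last:
  assumes "central_partition V m \<beta>"
  shows "level_degree V m \<beta> m = 0"
proof -
  have no: "{x \<in> V. \<beta> x \<le> 0} = {}"
    using assms unfolding central_partition_def by fastforce
  then show ?thesis unfolding level_degree_def by (simp only: diff_self_eq_0 no card.empty diff_0_eq_0)
qed

lemma central_partition_pos:
  assumes "central_partition V m \<beta>"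
  shows "1 \<le> m"
proof -
  have "0 < card {x \<in> V. \<beta> x = (m + 1) div 2}"
    using assms by (simp add: central_partition_def)
  then obtain x where "x \<in> V" by (auto simp: card_gt_0_iff)
  then have "\<beta> x \<in> {1..m}" using assms unfolding central_partition_def by blast
  then show ?thesis by simp
qed

text \<open>By strict decrease, the degrees above that of level \<open>k\<close> are the pairwise
  distinct values of the levels below \<open>k\<close>, all inhabited. Level \<open>k\<close> itself
  may be empty, so \<open>k = m\<close> is covered.\<close>

lemma card_larger_level_degrees:
  assumes V: "finite V" and part: "central_partition V m \<beta>" and k: "1 \<le> k" "k \<le> m"
  shows "card {d \<in> degree (level_graph V m \<beta>) ` V. level_degree V m \<beta> k < d} + 1 = k"
proof -
  let ?D = "level_degree V m \<beta>"
  have less: "?D j < ?D i" if "1 \<le> i" "i < j" "j \<le> m" for i j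
    using level_degree_less[OF V part that] .
  have mono: "i < j" if "1 \<le> j" "i \<le> m" "?D j < ?D i" for i j
    by (metis less less_asym that linorder_neqE_nat)
  have rng: "1 \<le> \<beta> v" "\<beta> v \<le> m" if "v \<in> V" for v
    using part that unfolding central_partition_def by auto
  have "degree (level_graph V m \<beta>) ` V = ?D ` \<beta> ` V"
    using degree_level_graph[OF V] rng by (auto simp: image_iff)
  moreover have "{d \<in> ?D ` \<beta> ` V. ?D k < d} = ?D ` {1..<k}"
  proof (intro set_eqI iffI)
    fix d assume "d \<in> {d \<in> ?D ` \<beta> ` V. ?D k < d}"
    then obtain v where "v \<in> V" "d = ?D (\<beta> v)" "?D k < ?D (\<beta> v)" by auto
    then show "d \<in> ?D ` {1..<k}"
      using mono[of k "\<beta> v"] rng k by auto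
  next
    fix d assume "d \<in> ?D ` {1..<k}"
    then obtain i where i: "1 \<le> i" "i < k" "d = ?D i" by auto
    then have "i \<in> \<beta> ` V" using part k unfolding central_partition_def by auto
    then show "d \<in> {d \<in> ?D ` \<beta> ` V. ?D k < d}"
      using less[of i k] i k by auto
  qed
  moreover have "inj_on ?D {1..<k}"
    using less k by (intro linorder_inj_onI) (fastforce, auto)
  ultimately show ?thesis
    using k by (simp add: card_image)
qed

text \<open>The value at level \<open>m\<close> is 0, so \<open>m\<close> is one more than the
  number of distinct positive degrees. Likewise \<open>\<beta> v\<close> is one more than the number
  of distinct degrees exceeding that of \<open>v\<close>.\<close>

lemma level_graph_determines_partition:
  assumes V: "finite V" and part: "central_partition V m \<beta>" "central_partition V m' \<beta>'"
    and eq: "level_graph V m \<beta> = level_graph V m' \<beta>'"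
  shows "m = m'" "\<And>v. v \<in> V \<Longrightarrow> \<beta> v = \<beta>' v"
proof -
  have "card {d \<in> degree (level_graph V m \<beta>) ` V. 0 < d} + 1 = m"
    using card_larger_level_degrees[OF V part(1), of m] level_degree_last[OF part(1)]
      central_partition_pos[OF part(1)] by simp
  moreover have "card {d \<in> degree (level_graph V m' \<beta>') ` V. 0 < d} + 1 = m'"
    using card_larger_level_degrees[OF V part(2), of m'] level_degree_last[OF part(2)]
      central_partition_pos[OF part(2)] by simp
  ultimately show "m = m'" by (simp add: eq)
  have level: "card {d \<in> degree (level_graph V m \<beta>) ` V. degree (level_graph V m \<beta>) v < d} + 1 = \<beta> v"
    if "central_partition V m \<beta>" "v \<in> V" for m \<beta> v
  proof -
    have "1 \<le> \<beta> v" "\<beta> v \<le> m"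
      using that unfolding central_partition_def by auto
    then show ?thesis
      using card_larger_level_degrees[OF V that(1), of "\<beta> v"]
        degree_level_graph[OF V that(2), of \<beta> m] by simp
  qed
  show "\<beta> v = \<beta>' v" if "v \<in> V" for v
    using level[OF part(1) that] level[OF part(2) that] by (simp add: eq)
qed

lemma level_graph_equal_degree:
  assumes "finite V" "central_partition V m \<beta>" "u \<in> V" "v \<in> V"
    and "degree (level_graph V m \<beta>) u = degree (level_graph V m \<beta>) v"
  shows "\<beta> u = \<beta> v"
proof -
  have rng: "1 \<le> \<beta> x" "\<beta> x \<le> m" if "x \<in> V" for x
    using assms(2) that unfolding central_partition_def by auto
  have "level_degree V m \<beta> (\<beta> u) = level_degree V m \<beta> (\<beta> v)"
    using degree_level_graph[OF assms(1,3), of \<beta> m] degree_level_graph[OF assms(1,4), of \<beta> m]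
      rng assms(3-5) by simp
  then show ?thesis
    using level_degree_less[OF assms(1,2), of "\<beta> u" "\<beta> v"]
      level_degree_less[OF assms(1,2), of "\<beta> v" "\<beta> u"] rng assms(3,4)
    by (cases "\<beta> u" "\<beta> v" rule: linorder_cases) auto
qed

section \<open>Every threshold graph is a level graph\<close>

text \<open>Let \<open>v\<close> have maximal degree. Without alternating cycles neighbourhoods are
  nested, so every other neighbourhood lies in that of \<open>v\<close>, up to \<open>u\<close> and
  \<open>v\<close> themselves. If \<open>v\<close> is not dominating, any other non-neighbour
  \<open>x\<close> of \<open>v\<close> is isolated, since a neighbour of \<open>x\<close> would make
  \<open>x\<close> a neighbour of \<open>v\<close>.\<close>

lemma ex_isolated_or_dominating:
  assumes "finite V" "V \<noteq> {}" "symp R" "irreflp R" "\<not> alternating_cycle_in V R"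
  obtains x where "x \<in> V" "\<And>y. y \<in> V \<Longrightarrow> \<not> R x y"
  | x where "x \<in> V" "\<And>y. y \<in> V \<Longrightarrow> y \<noteq> x \<Longrightarrow> R x y"
proof -
  define N where "N v = {y \<in> V. R v y}" for v
  have sym: "R x y \<longleftrightarrow> R y x" for x y using assms(3) by (auto dest: sympD)
  have irr: "\<not> R x x" for x using assms(4) by (auto dest: irreflpD)
  obtain v where v: "v \<in> V" "(MAX u\<in>V. card (N u)) = card (N v)"
    using obtains_MAX[OF assms(1,2), of "\<lambda>u. card (N u)"] by blast
  have v_max: "card (N u) \<le> card (N v)" if "u \<in> V" for u
    unfolding v(2)[symmetric] using assms(1) that by simp
  have max: "N u - {v} \<subseteq> N v - {u}" if u: "u \<in> V" "u \<noteq> v" for u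
  proof (rule ccontr)
    assume "\<not> N u - {v} \<subseteq> N v - {u}"
    then obtain a where a: "a \<in> V" "R u a" "\<not> R v a" "a \<noteq> v"
      using irr by (auto simp: N_def)
    \<comment> \<open>Private neighbours \<open>a\<close> of \<open>u\<close> and \<open>b\<close>
      of \<open>v\<close> would form an alternating cycle, so one failing inclusion forces the
      reverse one.\<close>
    have sub: "N v - {u} \<subseteq> N u - {v}"
    proof (rule ccontr)
      assume "\<not> N v - {u} \<subseteq> N u - {v}"
      then obtain b where b: "b \<in> V" "R v b" "\<not> R u b" "b \<noteq> u"
        using irr by (auto simp: N_def)
      have "distinct [a, u, v, b] \<and> R a u \<and> R v b \<and> \<not> R a v \<and> \<not> R u b"
        using a b u irr sym by auto
      then have "alternating_cycle_in V R"
        unfolding alternating_cycle_in_def using a(1) b(1) u(1) v(1) by blast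
      then show False using assms(5) by simp
    qed
    have fin: "finite (N x)" for x using assms(1) by (simp add: N_def)
    have "a \<in> (N u - {v}) - (N v - {u})" using a by (auto simp: N_def)
    with sub have "N v - {u} \<subset> N u - {v}" by blast
    then have "card (N v - {u}) < card (N u - {v})"
      by (simp add: fin psubset_card_mono)
    \<comment> \<open>Restoring \<open>u\<close> and \<open>v\<close> changes both cardinalities by
      the same amount, so the strict inequality contradicts the choice of \<open>v\<close>.\<close>
    moreover have "u \<in> N v \<longleftrightarrow> v \<in> N u" using sym u v by (auto simp: N_def)
    ultimately have "card (N v) < card (N u)"
      using fin by (cases "u \<in> N v") (simp_all add: card_Diff_singleton_if)
    then show False using v_max[OF u(1)] by simp
  qed
  show thesis
  proof (cases "\<forall>y\<in>V. y \<noteq> v \<longrightarrow> R v y")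
    case True
    then show ?thesis using that(2) v(1) by blast
  next
    case False
    then obtain x where x: "x \<in> V" "x \<noteq> v" "\<not> R v x" by blast
    have "\<not> R x y" if y: "y \<in> V" for y
    proof
      assume R: "R x y"
      then have "y \<noteq> v" using x sym by blast
      then have "x \<in> N y - {v}" using R x sym by (auto simp: N_def)
      with max[OF y \<open>y \<noteq> v\<close>] have "R v x" by (auto simp: N_def)
      with x show False by simp
    qed
    then show ?thesis using that(1) x(1) by blast
  qed
qed

lemma central_partition_insert:
  assumes "finite V" "central_partition (V - {x}) m \<beta>" "k \<in> {1..m}"
  shows "central_partition V m (\<beta>(x := k))"
  unfolding central_partition_def
proof (intro conjI)
  have part: "\<beta> ` (V - {x}) \<subseteq> {1..m}" "{1..<m} \<subseteq> \<beta> ` (V - {x})"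
    "2 \<le> card {y \<in> V - {x}. \<beta> y = (m + 1) div 2}"
    using assms(2) by (simp_all add: central_partition_def)
  show "(\<beta>(x := k)) ` V \<subseteq> {1..m}"
    using part(1) assms(3) by (auto simp del: atLeastAtMost_iff)
  have "\<beta> ` (V - {x}) \<subseteq> (\<beta>(x := k)) ` V" by auto
  with part(2) show "{1..<m} \<subseteq> (\<beta>(x := k)) ` V" by (rule subset_trans)
  have "card {y \<in> V - {x}. \<beta> y = (m + 1) div 2} \<le> card {y \<in> V. (\<beta>(x := k)) y = (m + 1) div 2}"
    using assms(1) by (intro card_mono) auto
  with part(3) show "2 \<le> card {y \<in> V. (\<beta>(x := k)) y = (m + 1) div 2}" by (rule order_trans)
qed

lemma ex_central_partition:
  assumes "finite V" "2 \<le> card V" "symp R" "irreflp R" "\<not> alternating_cycle_in V R"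
  shows "\<exists>m \<beta>. central_partition V m \<beta> \<and>
    (\<forall>u\<in>V. \<forall>v\<in>V. u \<noteq> v \<longrightarrow> (R u v \<longleftrightarrow> \<beta> u + \<beta> v \<le> m))"
  using assms(1,2,5)
proof (induction "card V" arbitrary: V rule: less_induct)
  case (less V)
  have sym: "R x y \<longleftrightarrow> R y x" for x y using assms(3) by (auto dest: sympD)
  show ?case
  proof (cases "card V = 2")
    case True
    then obtain p q where V: "V = {p, q}" "p \<noteq> q" by (meson card_2_iff)
    \<comment> \<open>Two vertices on level 1 are joined iff \<open>2 \<le> m\<close>. For both
      values of \<open>m\<close> the central index is 1, so the pair itself is the central
      block.\<close>
    define m :: nat where "m = (if R p q then 2 else 1)"
    have "{x \<in> V. (1 :: nat) = (m + 1) div 2} = V" by (auto simp: m_def)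
    then have "central_partition V m (\<lambda>_. 1)"
      using True V by (auto simp: central_partition_def m_def)
    moreover have "\<forall>u\<in>V. \<forall>v\<in>V. u \<noteq> v \<longrightarrow> (R u v \<longleftrightarrow> 1 + 1 \<le> m)"
      using V sym by (auto simp: m_def)
    ultimately show ?thesis by blast
  next
    case False
    with less.prems have ne: "V \<noteq> {}" and c3: "3 \<le> card V" by auto
    have step: "\<exists>m \<beta>. central_partition (V - {x}) m \<beta> \<and>
        (\<forall>u\<in>V - {x}. \<forall>v\<in>V - {x}. u \<noteq> v \<longrightarrow> (R u v \<longleftrightarrow> \<beta> u + \<beta> v \<le> m))"
      if "x \<in> V" for x
    proof (rule less.hyps)
      show "card (V - {x}) < card V" "2 \<le> card (V - {x})"
        using that c3 less.prems(1) by (auto simp: card_gt_0_iff)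
      show "\<not> alternating_cycle_in (V - {x}) R"
        using less.prems(3) alternating_cycle_in_mono[of "V - {x}" R V] by blast
    qed (use less.prems in auto)
    consider (iso) x where "x \<in> V" "\<And>y. y \<in> V \<Longrightarrow> \<not> R x y"
      | (dom) x where "x \<in> V" "\<And>y. y \<in> V \<Longrightarrow> y \<noteq> x \<Longrightarrow> R x y"
      using ex_isolated_or_dominating[OF less.prems(1) ne assms(3,4) less.prems(3)] by metis
    then show ?thesis
    proof cases
      case iso
      from step[OF iso(1)] obtain m \<beta> where part: "central_partition (V - {x}) m \<beta>"
        and R: "\<forall>u\<in>V - {x}. \<forall>v\<in>V - {x}. u \<noteq> v \<longrightarrow> (R u v \<longleftrightarrow> \<beta> u + \<beta> v \<le> m)"
        by blast
      \<comment> \<open>Levels are at least 1, so any sum with \<open>m\<close> exceeds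
        \<open>m\<close>.\<close>
      let ?\<beta> = "\<beta>(x := m)"
      have rng: "1 \<le> \<beta> y" "\<beta> y \<le> m" if "y \<in> V" "y \<noteq> x" for y
        using part that unfolding central_partition_def by auto
      have "central_partition V m ?\<beta>"
        using central_partition_insert[OF less.prems(1) part] central_partition_pos[OF part] by simp
      moreover have "R u v \<longleftrightarrow> ?\<beta> u + ?\<beta> v \<le> m" if "u \<in> V" "v \<in> V" "u \<noteq> v" for u v
      proof -
        consider "u = x" | "v = x" | "u \<noteq> x" "v \<noteq> x" by blast
        then show ?thesis
        proof cases
          case 1
          then show ?thesis using iso(2)[of v] rng(1)[of v] that by simp
        next
          case 2
          then show ?thesis using iso(2)[of u] sym[of u x] rng(1)[of u] that by simp
        qed (use R that in simp)
      qed
      ultimately show ?thesis by blast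
    next
      case dom
      from step[OF dom(1)] obtain m \<beta> where part: "central_partition (V - {x}) m \<beta>"
        and R: "\<forall>u\<in>V - {x}. \<forall>v\<in>V - {x}. u \<noteq> v \<longrightarrow> (R u v \<longleftrightarrow> \<beta> u + \<beta> v \<le> m)"
        by blast
      have rng: "1 \<le> \<beta> y" "\<beta> y \<le> m" if "y \<in> V" "y \<noteq> x" for y
        using part that unfolding central_partition_def by auto
      have m: "1 \<le> m" using central_partition_pos[OF part] .
      show ?thesis
      proof (cases "m \<in> \<beta> ` (V - {x})")
        case False
        \<comment> \<open>Level \<open>m\<close> is empty here, so the other levels are below
          \<open>m\<close> and their sums with 1 stay within \<open>m\<close>.\<close>
        let ?\<beta> = "\<beta>(x := 1)"
        have rng': "\<beta> y < m" if "y \<in> V" "y \<noteq> x" for y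
          using rng[OF that] False that by (force simp: le_less)
        have "central_partition V m ?\<beta>"
          using central_partition_insert[OF less.prems(1) part] m by simp
        moreover have "R u v \<longleftrightarrow> ?\<beta> u + ?\<beta> v \<le> m" if "u \<in> V" "v \<in> V" "u \<noteq> v" for u v
        proof -
          consider "u = x" | "v = x" | "u \<noteq> x" "v \<noteq> x" by blast
          then show ?thesis
          proof cases
            case 1
            then show ?thesis using dom(2)[of v] rng'[of v] that by simp
          next
            case 2
            then show ?thesis using dom(2)[of u] sym[of u x] rng'[of u] that by simp
          qed (use R that in simp)
        qed
        ultimately show ?thesis by blast
      next
        case True
        \<comment> \<open>Raising old levels by 1 and \<open>m\<close> by 2 keeps the old
          adjacencies and shifts the central index by 1 along with its level. Old levels now lie in
          2 to \<open>m + 1\<close>, so level 1 dominates and level \<open>m + 2\<close> is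
          empty.\<close>
        let ?\<beta> = "\<lambda>y. if y = x then 1 else \<beta> y + 1"
        have "card {y \<in> V - {x}. \<beta> y = (m + 1) div 2} \<le> card {y \<in> V. ?\<beta> y = (m + 2 + 1) div 2}"
          using less.prems(1) by (intro card_mono) auto
        moreover have "2 \<le> card {y \<in> V - {x}. \<beta> y = (m + 1) div 2}"
          using part by (simp add: central_partition_def)
        moreover have "?\<beta> y \<in> {1..m + 2}" if "y \<in> V" for y
          using rng(2)[of y] that by auto
        moreover have "{1..<m + 2} \<subseteq> ?\<beta> ` V"
        proof
          fix k assume k: "k \<in> {1..<m + 2}"
          show "k \<in> ?\<beta> ` V"
          proof (cases "k = 1")
            case False
            then have "k - 1 \<in> {1..<m} \<union> {m}" using k by auto
            then have "k - 1 \<in> \<beta> ` (V - {x})"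
              using part True unfolding central_partition_def by blast
            then obtain y where "y \<in> V" "y \<noteq> x" "k - 1 = \<beta> y" by blast
            then show ?thesis using k by (intro image_eqI[of _ _ y]) auto
          qed (use dom(1) in \<open>auto intro: image_eqI[of _ _ x]\<close>)
        qed
        ultimately have "central_partition V (m + 2) ?\<beta>"
          unfolding central_partition_def by (intro conjI image_subsetI) simp_all
        moreover have "R u v \<longleftrightarrow> ?\<beta> u + ?\<beta> v \<le> m + 2" if "u \<in> V" "v \<in> V" "u \<noteq> v" for u v
        proof -
          consider "u = x" | "v = x" | "u \<noteq> x" "v \<noteq> x" by blast
          then show ?thesis
          proof cases
            case 1
            then show ?thesis using dom(2)[of v] rng[of v] that by simp
          next
            case 2
            then show ?thesis using dom(2)[of u] sym[of u x] rng[of u] that by simp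
          qed (use R that in simp)
        qed
        ultimately show ?thesis by blast
      qed
    qed
  qed
qed

lemma threshold_is_level_graph:
  assumes "threshold (V, E)" "2 \<le> card V"
  obtains m \<beta> where "central_partition V m \<beta>" "(V, E) = level_graph V m \<beta>"
proof -
  have simple: "simple_graph (V, E)" using assms(1) by (simp add: threshold_def)
  then have V: "finite V" and E: "\<And>e. e \<in> E \<Longrightarrow> e \<subseteq> V \<and> card e = 2"
    by (auto simp: simple_graph_def)
  define R where "R = (\<lambda>u v. {u, v} \<in> E)"
  have "symp R" by (auto simp: R_def symp_def insert_commute)
  moreover have "irreflp R" using E by (fastforce simp: R_def irreflp_def)
  moreover have "\<not> alternating_cycle_in V R"
    using assms(1) threshold_iff_no_alternating_cycle[OF simple] by (simp add: R_def)
  ultimately obtain m \<beta> where part: "central_partition V m \<beta>"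
    and R: "\<And>u v. u \<in> V \<Longrightarrow> v \<in> V \<Longrightarrow> u \<noteq> v \<Longrightarrow> {u, v} \<in> E \<longleftrightarrow> \<beta> u + \<beta> v \<le> m"
    using ex_central_partition[OF V assms(2), of R] by (auto simp: R_def)
  have "E = {{u, v} | u v. u \<in> V \<and> v \<in> V \<and> u \<noteq> v \<and> \<beta> u + \<beta> v \<le> m}"
  proof (intro set_eqI iffI)
    fix e assume e: "e \<in> E"
    then obtain u v where "e = {u, v}" "u \<noteq> v" using E by (meson card_2_iff)
    then show "e \<in> {{u, v} | u v. u \<in> V \<and> v \<in> V \<and> u \<noteq> v \<and> \<beta> u + \<beta> v \<le> m}"
      using E[OF e] R e by blast
  qed (use R in blast)
  then show thesis using that part by (simp add: level_graph_def)
qed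

section \<open>Normal barred permutations as ordered set partitions\<close>

lemma card_filter_less:
  assumes "finite A" "x \<in> A" "\<not> P x" "Q x" "\<And>y. y \<in> A \<Longrightarrow> P y \<Longrightarrow> Q y"
  shows "card {y \<in> A. P y} < card {y \<in> A. Q y}"
  using assms by (intro psubset_card_mono) auto

text \<open>This is the level function of a barred permutation, stated for letters because these are
  the vertices; \<open>inv (fst p) x\<close> is the position of the letter \<open>x\<close>.\<close>

definition block_index :: "barred_perm \<Rightarrow> nat \<Rightarrow> nat" where
  "block_index p x = card {b \<in> snd p. b < inv (fst p) x} + 1"

lemma block_eq:
  assumes "simply_barred n p"
  shows "block n p k = {x \<in> {1..n}. block_index p x = k}"
proof -
  obtain w B where p: "p = (w, B)" by (cases p)
  have w: "w permutes {1..n}" using assms by (simp add: p simply_barred_def)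
  show ?thesis
  proof (intro set_eqI iffI)
    fix x assume "x \<in> block n p k"
    then obtain i where "i \<in> {1..n}" "x = w i" "card {b \<in> B. b < i} + 1 = k"
      by (auto simp: p block_def)
    then show "x \<in> {x \<in> {1..n}. block_index p x = k}"
      using permutes_in_image[OF w, of i] permutes_inverses(2)[OF w]
      by (simp add: p block_index_def)
  next
    fix x assume "x \<in> {x \<in> {1..n}. block_index p x = k}"
    then show "x \<in> block n p k"
      using permutes_in_image[OF permutes_inv[OF w], of x] permutes_inverses(1)[OF w]
      by (auto simp: p block_def block_index_def intro!: image_eqI[of _ _ "inv w x"])
  qed
qed

lemma simply_barred_finite: "simply_barred n p \<Longrightarrow> finite (snd p)"
  by (cases p) (auto simp: simply_barred_def intro: finite_subset)

lemma block_index_le: "simply_barred n p \<Longrightarrow> block_index p x \<le> card (snd p) + 1"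
  by (auto simp: block_index_def intro: card_mono simply_barred_finite)

lemma same_block_iff:
  assumes "simply_barred n p"
  shows "same_block n p x y \<longleftrightarrow> x \<in> {1..n} \<and> y \<in> {1..n} \<and> block_index p x = block_index p y"
  using block_index_le[OF assms, of x]
  by (auto simp: same_block_def block_eq[OF assms] block_index_def)

lemma central_block_eq:
  assumes "simply_barred n p"
  shows "central_block n p = {x \<in> {1..n}. block_index p x = (card (snd p) + 1 + 1) div 2}"
proof -
  have "nat \<lceil>real m / 2\<rceil> = (m + 1) div 2" for m
  proof -
    have "\<lceil>real m / 2\<rceil> = int ((m + 1) div 2)"
      by (rule ceiling_unique) linarith+
    then show ?thesis by simp
  qed
  then show ?thesis
    unfolding central_block_def block_eq[OF assms] by metis
qed

text \<open>The \<open>k\<close>-th bar stands after as many letters as there are in the first \<open>k\<close> blocks.\<close>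

lemma bar_position:
  assumes "simply_barred n p" "b \<in> snd p"
  shows "card {x \<in> {1..n}. block_index p x \<le> card {b' \<in> snd p. b' \<le> b}} = b"
proof -
  obtain w B where p: "p = (w, B)" by (cases p)
  have w: "w permutes {1..n}" and B: "B \<subseteq> {1..n}" "b \<in> B"
    using assms by (auto simp: p simply_barred_def)
  have fin: "finite B" using B(1) by (rule finite_subset) simp
  \<comment> \<open>The right-hand count is the rank of \<open>b\<close> among the bars. For
    \<open>i \<le> b\<close> it includes \<open>b\<close> itself, which the left-hand count omits;
    this pays for the \<open>+ 1\<close>.\<close>
  have iff: "card {b' \<in> B. b' < i} + 1 \<le> card {b' \<in> B. b' \<le> b} \<longleftrightarrow> i \<le> b" for i
  proof
    assume "i \<le> b"
    then have "card {b' \<in> B. b' < i} < card {b' \<in> B. b' \<le> b}"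
      using fin B(2) by (intro card_filter_less[of _ b]) auto
    then show "card {b' \<in> B. b' < i} + 1 \<le> card {b' \<in> B. b' \<le> b}" by simp
  next
    assume *: "card {b' \<in> B. b' < i} + 1 \<le> card {b' \<in> B. b' \<le> b}"
    show "i \<le> b"
    proof (rule ccontr)
      assume "\<not> i \<le> b"
      then have "card {b' \<in> B. b' \<le> b} \<le> card {b' \<in> B. b' < i}"
        using fin by (intro card_mono) auto
      with * show False by simp
    qed
  qed
  have "{x \<in> {1..n}. inv w x \<le> b} = w ` {1..b}"
  proof (intro set_eqI iffI)
    fix x assume "x \<in> {x \<in> {1..n}. inv w x \<le> b}"
    then show "x \<in> w ` {1..b}"
      using permutes_in_image[OF permutes_inv[OF w], of x] permutes_inverses(1)[OF w]
      by (auto intro!: image_eqI[of _ _ "inv w x"])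
  next
    fix x assume "x \<in> w ` {1..b}"
    then obtain i where "i \<in> {1..b}" "x = w i" by blast
    then show "x \<in> {x \<in> {1..n}. inv w x \<le> b}"
      using B permutes_in_image[OF w, of i] permutes_inverses(2)[OF w] by auto
  qed
  then show ?thesis
    using permutes_inj[OF w] by (simp add: p block_index_def iff[simplified] card_image inj_on_subset)
qed

lemma rank_image:
  fixes B :: "nat set"
  assumes "finite B"
  shows "(\<lambda>b. card {b' \<in> B. b' \<le> b}) ` B = {1..card B}"
proof (rule card_subset_eq)
  let ?r = "\<lambda>b. card {b' \<in> B. b' \<le> b}"
  show "?r ` B \<subseteq> {1..card B}"
    using assms by (auto simp: Suc_le_eq card_gt_0_iff intro: card_mono)
  have "?r a < ?r b" if "a < b" "b \<in> B" for a b
    using assms that by (intro card_filter_less[of _ b]) auto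
  then have "inj_on ?r B"
    by (intro linorder_inj_onI) (fastforce, auto)
  then show "card (?r ` B) = card {1..card B}" by (simp add: card_image)
qed simp

text \<open>The ranks of the bars run through \<open>1\<close> to \<open>card (snd p)\<close>, and
  \<open>bar_position\<close> recovers each bar from its rank. Hence block sizes determine the
  bars.\<close>

lemma bars_eq:
  assumes "simply_barred n p"
  shows "snd p = (\<lambda>k. card {x \<in> {1..n}. block_index p x \<le> k}) ` {1..card (snd p)}"
  unfolding rank_image[OF simply_barred_finite[OF assms], symmetric] image_image
  using bar_position[OF assms] by simp

lemma block_index_less:
  assumes "simply_barred n p" "block_index p x < block_index p y"
  shows "inv (fst p) x < inv (fst p) y"
proof (rule ccontr)
  assume "\<not> ?thesis"
  then have "card {b \<in> snd p. b < inv (fst p) y} \<le> card {b \<in> snd p. b < inv (fst p) x}"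
    using simply_barred_finite[OF assms(1)] by (intro card_mono) auto
  then show False using assms(2) by (simp add: block_index_def)
qed

text \<open>This is the position of \<open>x\<close> in the word that lists the levels in order,
  each of them increasingly.\<close>

definition lex_rank :: "nat \<Rightarrow> (nat \<Rightarrow> nat) \<Rightarrow> nat \<Rightarrow> nat" where
  "lex_rank n \<beta> x = card {y \<in> {1..n}. \<beta> y < \<beta> x \<or> \<beta> y = \<beta> x \<and> y \<le> x}"

lemma lex_rank_cong:
  assumes "\<And>y. y \<in> {1..n} \<Longrightarrow> \<beta> y = \<beta>' y" "x \<in> {1..n}"
  shows "lex_rank n \<beta> x = lex_rank n \<beta>' x"
proof -
  have "{y \<in> {1..n}. \<beta> y < \<beta> x \<or> \<beta> y = \<beta> x \<and> y \<le> x} =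
      {y \<in> {1..n}. \<beta>' y < \<beta>' x \<or> \<beta>' y = \<beta>' x \<and> y \<le> x}"
    using assms by auto
  then show ?thesis by (simp add: lex_rank_def)
qed

lemma lex_rank_less:
  assumes "y \<in> {1..n}" "\<beta> x < \<beta> y \<or> \<beta> x = \<beta> y \<and> x < y"
  shows "lex_rank n \<beta> x < lex_rank n \<beta> y"
  unfolding lex_rank_def using assms by (intro card_filter_less[of _ y]) auto

lemma normal_less_iff:
  assumes "simply_barred n p" "normal n p" "x \<in> {1..n}" "y \<in> {1..n}"
  shows "inv (fst p) y \<le> inv (fst p) x \<longleftrightarrow>
    block_index p y < block_index p x \<or> block_index p y = block_index p x \<and> y \<le> x"
proof -
  have norm: "inv (fst p) i < inv (fst p) j"
    if "i < j" "i \<in> {1..n}" "j \<in> {1..n}" "block_index p i = block_index p j" for i j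
    using assms(2) that unfolding normal_def same_block_iff[OF assms(1)] by blast
  consider "block_index p y < block_index p x" | "block_index p x < block_index p y"
    | "block_index p y = block_index p x" by linarith
  then show ?thesis
  proof cases
    case 3
    then show ?thesis
      using norm[of x y] norm[of y x] assms(3,4)
      by (cases x y rule: linorder_cases) auto
  qed (use block_index_less[OF assms(1)] in fastforce)+
qed

text \<open>Normality makes the order of positions the lexicographic order by block, then letter.
  The letters up to \<open>x\<close> in it fill the positions up to that of \<open>x\<close>, so
  counting them gives this position.\<close>

lemma normal_position:
  assumes "simply_barred n p" "normal n p" "x \<in> {1..n}"
  shows "inv (fst p) x = lex_rank n (block_index p) x"
proof -
  have w: "fst p permutes {1..n}" using assms(1) by (cases p) (simp add: simply_barred_def)
  have iv: "inv (fst p) permutes {1..n}" using permutes_inv[OF w] .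
  have ix: "inv (fst p) x \<in> {1..n}" using permutes_in_image[OF iv] assms(3) by blast
  have "{y \<in> {1..n}. block_index p y < block_index p x \<or>
      block_index p y = block_index p x \<and> y \<le> x} = {y \<in> {1..n}. inv (fst p) y \<le> inv (fst p) x}"
    using normal_less_iff[OF assms] by blast
  also have "\<dots> = fst p ` {1..inv (fst p) x}"
  proof (intro set_eqI iffI)
    fix y assume "y \<in> {y \<in> {1..n}. inv (fst p) y \<le> inv (fst p) x}"
    then show "y \<in> fst p ` {1..inv (fst p) x}"
      using permutes_in_image[OF iv, of y] permutes_inverses(1)[OF w]
      by (auto intro!: image_eqI[of _ _ "inv (fst p) y"])
  next
    fix y assume "y \<in> fst p ` {1..inv (fst p) x}"
    then obtain i where "i \<in> {1..inv (fst p) x}" "y = fst p i" by blast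
    then show "y \<in> {y \<in> {1..n}. inv (fst p) y \<le> inv (fst p) x}"
      using ix permutes_in_image[OF w, of i] permutes_inverses(2)[OF w] by auto
  qed
  finally show ?thesis
    using permutes_inj[OF w] by (simp add: lex_rank_def card_image inj_on_subset)
qed

text \<open>Block indices fix all positions, but they cannot see a bar after position
  \<open>n\<close>; the number of bars supplies this information.\<close>

lemma normal_barred_perm_eqI:
  assumes "simply_barred n p" "normal n p" "simply_barred n q" "normal n q"
    and card: "card (snd p) = card (snd q)"
    and index: "\<And>x. x \<in> {1..n} \<Longrightarrow> block_index p x = block_index q x"
  shows "p = q"
proof (rule prod_eqI)
  have "{x \<in> {1..n}. block_index p x \<le> k} = {x \<in> {1..n}. block_index q x \<le> k}" for k
    using index by auto
  then have "snd p = (\<lambda>k. card {x \<in> {1..n}. block_index q x \<le> k}) ` {1..card (snd q)}"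
    by (subst bars_eq[OF assms(1)]) (simp add: card)
  also have "\<dots> = snd q" by (rule bars_eq[OF assms(3), symmetric])
  finally show "snd p = snd q" .
  have w: "fst p permutes {1..n}" "fst q permutes {1..n}"
    using assms(1,3) by (cases p; cases q; simp add: simply_barred_def)+
  have "inv (fst p) x = inv (fst q) x" for x
  proof (cases "x \<in> {1..n}")
    case True
    then show ?thesis
      using normal_position[OF assms(1,2)] normal_position[OF assms(3,4)]
        lex_rank_cong[of n "block_index p" "block_index q"] index by simp
  next
    case False
    then show ?thesis
      using permutes_not_in[OF permutes_inv[OF w(1)]] permutes_not_in[OF permutes_inv[OF w(2)]]
      by metis
  qed
  then have "inv (fst p) = inv (fst q)" by blast
  then show "fst p = fst q" using w by (metis permutes_inv_inv)
qed

lemma ex_normal_barred_perm: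
  assumes "1 \<le> m" "\<beta> ` {1..n} \<subseteq> {1..m}" "{1..<m} \<subseteq> \<beta> ` {1..n}"
  obtains p where "simply_barred n p" "normal n p" "card (snd p) + 1 = m"
    "\<And>x. x \<in> {1..n} \<Longrightarrow> block_index p x = \<beta> x"
proof -
  \<comment> \<open>\<open>c k\<close> is the position where level \<open>k\<close> ends. Inhabited
    levels below \<open>m\<close> make these bars distinct, and the last of them is \<open>n\<close>
    iff level \<open>m\<close> is empty (for \<open>m > 1\<close>).\<close>
  define c where "c k = card {x \<in> {1..n}. \<beta> x \<le> k}" for k
  define B where "B = c ` {1..<m}"
  let ?r = "lex_rank n \<beta>"
  have r_inj: "inj_on ?r {1..n}"
  proof (rule inj_onI)
    fix x y assume "x \<in> {1..n}" "y \<in> {1..n}" "?r x = ?r y"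
    then show "x = y"
      using lex_rank_less[of y n \<beta> x] lex_rank_less[of x n \<beta> y]
      by (cases "\<beta> x" "\<beta> y" rule: linorder_cases; cases x y rule: linorder_cases) auto
  qed
  have "?r ` {1..n} \<subseteq> {1..n}"
  proof
    fix k assume "k \<in> ?r ` {1..n}"
    then obtain x where x: "x \<in> {1..n}" "k = ?r x" by blast
    have "?r x \<le> card {1..n}" unfolding lex_rank_def by (intro card_mono) auto
    moreover have "0 < ?r x" unfolding lex_rank_def using x by (auto simp: card_gt_0_iff)
    ultimately show "k \<in> {1..n}" using x by simp
  qed
  then have "?r ` {1..n} = {1..n}" using r_inj by (simp add: endo_inj_surj)
  then have bij: "bij_betw ?r {1..n} {1..n}" using r_inj by (simp add: bij_betw_def)
  \<comment> \<open>\<open>v\<close> sends letters to positions, so the word is its inverse.\<close>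
  define v where "v x = (if x \<in> {1..n} then ?r x else x)" for x
  have v: "v permutes {1..n}"
  proof (rule bij_imp_permutes)
    show "bij_betw v {1..n} {1..n}"
      using bij by (rule bij_betw_cong[THEN iffD1, rotated]) (simp add: v_def)
    show "v x = x" if "x \<notin> {1..n}" for x
      unfolding v_def using that by (rule if_not_P)
  qed
  have c_less: "c k < c l" if "k < l" "l \<in> {1..<m}" for k l
  proof -
    have "l \<in> \<beta> ` {1..n}" using that(2) assms(3) by blast
    then obtain x where "x \<in> {1..n}" "\<beta> x = l" by blast
    then show ?thesis unfolding c_def using that by (intro card_filter_less[of _ x]) auto
  qed
  have c_inj: "inj_on c {1..<m}"
    using c_less by (intro linorder_inj_onI) (fastforce, auto)
  have "c k \<in> {1..n}" if "k \<in> {1..<m}" for k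
  proof -
    have "c k \<le> card {1..n}" unfolding c_def by (intro card_mono) auto
    then show ?thesis using c_less[of 0 k] that by simp
  qed
  then have B: "B \<subseteq> {1..n}" by (auto simp: B_def)
  let ?p = "(inv v, B)"
  have inv: "inv (inv v) = v" using permutes_inv_inv[OF v] .
  have sb: "simply_barred n ?p"
    using permutes_inv[OF v] B by (simp add: simply_barred_def)
  have index: "block_index ?p x = \<beta> x" if x: "x \<in> {1..n}" for x
  proof -
    have iff: "c k < ?r x \<longleftrightarrow> k < \<beta> x" for k
    proof
      assume "k < \<beta> x"
      then show "c k < ?r x"
        unfolding c_def lex_rank_def using x by (intro card_filter_less[of _ x]) auto
    next
      assume less: "c k < ?r x"
      show "k < \<beta> x"
      proof (rule ccontr)
        assume "\<not> k < \<beta> x"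
        then have "?r x \<le> c k" unfolding c_def lex_rank_def by (intro card_mono) auto
        with less show False by simp
      qed
    qed
    have "\<beta> x \<in> {1..m}" using assms(2) x by blast
    then have "{k \<in> {1..<m}. c k < ?r x} = {1..<\<beta> x}" unfolding iff by auto
    moreover have "{b \<in> B. b < ?r x} = c ` {k \<in> {1..<m}. c k < ?r x}"
      unfolding B_def by blast
    moreover have "inj_on c {1..<\<beta> x}"
      using c_inj \<open>\<beta> x \<in> {1..m}\<close> by (auto intro: inj_on_subset)
    moreover have "v x = ?r x" using x by (simp add: v_def)
    ultimately have "block_index ?p x = card {1..<\<beta> x} + 1"
      by (simp add: block_index_def inv card_image)
    then show ?thesis using \<open>\<beta> x \<in> {1..m}\<close> by simp
  qed
  have "normal n ?p"
    unfolding normal_def same_block_iff[OF sb]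
  proof (intro allI impI, elim conjE)
    fix i j assume ij: "i < j" "i \<in> {1..n}" "j \<in> {1..n}" "block_index ?p i = block_index ?p j"
    then have "?r i < ?r j" using index by (intro lex_rank_less) auto
    then show "inv (fst ?p) i < inv (fst ?p) j" using ij by (simp add: inv v_def)
  qed
  moreover have "card (snd ?p) + 1 = m"
    using c_inj assms(1) by (simp add: B_def card_image)
  ultimately show thesis by (intro that[of ?p] sb index)
qed

lemma block_index_image:
  assumes "simply_barred n p"
  shows "block_index p ` {1..n} \<subseteq> {1..card (snd p) + 1}"
    and "{1..<card (snd p) + 1} \<subseteq> block_index p ` {1..n}"
proof -
  show "block_index p ` {1..n} \<subseteq> {1..card (snd p) + 1}"
    using block_index_le[OF assms] by (auto simp: block_index_def)
  have w: "fst p permutes {1..n}" and B: "snd p \<subseteq> {1..n}"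
    using assms by (cases p; simp add: simply_barred_def)+
  show "{1..<card (snd p) + 1} \<subseteq> block_index p ` {1..n}"
  proof
    fix k assume "k \<in> {1..<card (snd p) + 1}"
    then have "k \<in> (\<lambda>b. card {b' \<in> snd p. b' \<le> b}) ` snd p"
      unfolding rank_image[OF simply_barred_finite[OF assms]] by auto
    then obtain b where b: "b \<in> snd p" "k = card {b' \<in> snd p. b' \<le> b}" by blast
    \<comment> \<open>The \<open>k\<close>-th bar \<open>b\<close> closes block \<open>k\<close>, so
      the letter at position \<open>b\<close> witnesses that this block is inhabited.\<close>
    have "{b' \<in> snd p. b' \<le> b} = insert b {b' \<in> snd p. b' < b}" using b by auto
    then have "k = card {b' \<in> snd p. b' < b} + 1"
      using b simply_barred_finite[OF assms] by simp
    then have "k = block_index p (fst p b)"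
      by (simp add: block_index_def permutes_inverses(2)[OF w])
    moreover have "fst p b \<in> {1..n}" using permutes_in_image[OF w] b B by blast
    ultimately show "k \<in> block_index p ` {1..n}" by blast
  qed
qed

lemma central_partition_block_index:
  assumes "simply_barred n p"
  shows "central_partition {1..n} (card (snd p) + 1) (block_index p) \<longleftrightarrow>
    2 \<le> card (central_block n p)"
  using block_index_image[OF assms]
  unfolding central_partition_def central_block_eq[OF assms] by simp

section \<open>The bijection between barred permutations and threshold graphs\<close>

definition graph_of_barred_perm :: "nat \<Rightarrow> barred_perm \<Rightarrow> nat ugraph" where
  "graph_of_barred_perm n p = level_graph {1..n} (card (snd p) + 1) (block_index p)"

lemma central_barred_permsD:
  assumes "p \<in> central_barred_perms n"
  shows "simply_barred n p" "normal n p"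
    "central_partition {1..n} (card (snd p) + 1) (block_index p)"
proof -
  show "simply_barred n p" "normal n p" using assms by (simp_all add: central_barred_perms_def)
  then show "central_partition {1..n} (card (snd p) + 1) (block_index p)"
    using assms unfolding central_partition_block_index[OF \<open>simply_barred n p\<close>]
    by (simp add: central_barred_perms_def)
qed

lemma bij_betw_graph_of_barred_perm:
  assumes "n \<ge> 2"
  shows "bij_betw (graph_of_barred_perm n) (central_barred_perms n) (threshold_graphs n)"
  unfolding bij_betw_def
proof (intro conjI inj_onI subset_antisym subsetI)
  fix p q assume p: "p \<in> central_barred_perms n" and q: "q \<in> central_barred_perms n"
    and eq: "graph_of_barred_perm n p = graph_of_barred_perm n q"
  note det = level_graph_determines_partition[OF finite_atLeastAtMost central_barred_permsD(3)[OF p]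
      central_barred_permsD(3)[OF q] eq[unfolded graph_of_barred_perm_def]]
  show "p = q"
  proof (rule normal_barred_perm_eqI[OF central_barred_permsD(1,2)[OF p] central_barred_permsD(1,2)[OF q]])
    show "card (snd p) = card (snd q)" using det(1) by simp
  qed (rule det(2))
next
  fix G assume "G \<in> graph_of_barred_perm n ` central_barred_perms n"
  then show "G \<in> threshold_graphs n"
    by (auto simp: graph_of_barred_perm_def threshold_graphs_def threshold_level_graph)
next
  fix G assume "G \<in> threshold_graphs n"
  then obtain E where G: "G = ({1..n}, E)" "threshold ({1..n}, E)"
    by (cases G) (auto simp: threshold_graphs_def)
  obtain m \<beta> where part: "central_partition {1..n} m \<beta>" and eq: "G = level_graph {1..n} m \<beta>"
    using threshold_is_level_graph[OF G(2)] assms G(1) by auto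
  then obtain p where p: "simply_barred n p" "normal n p" "card (snd p) + 1 = m"
    and index: "\<And>x. x \<in> {1..n} \<Longrightarrow> block_index p x = \<beta> x"
    using ex_normal_barred_perm[of m \<beta> n] central_partition_pos[OF part]
    unfolding central_partition_def by blast
  have "{x \<in> {1..n}. block_index p x = k} = {x \<in> {1..n}. \<beta> x = k}" for k
    using index by auto
  then have "2 \<le> card (central_block n p)"
    using part p(3) unfolding central_block_eq[OF p(1)] central_partition_def by simp
  then have "p \<in> central_barred_perms n"
    using p by (simp add: central_barred_perms_def)
  moreover have "graph_of_barred_perm n p = G"
    unfolding graph_of_barred_perm_def eq p(3) using index by (rule level_graph_cong)
  ultimately show "G \<in> graph_of_barred_perm n ` central_barred_perms n" by blast
qed

theorem mainTheorem6:
  fixes n :: nat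
  assumes "n \<ge> 2"
  shows "\<exists>\<phi>. bij_betw \<phi> (threshold_graphs n) (central_barred_perms n) \<and>
    (\<forall>G \<in> threshold_graphs n. \<forall>u \<in> {1..n}. \<forall>v \<in> {1..n}.
       degree G u = degree G v \<longrightarrow> same_block n (\<phi> G) u v)"
proof (intro exI conjI ballI impI)
  let ?\<psi> = "graph_of_barred_perm n"
  \<comment> \<open>The explicit map goes from barred permutations to graphs, so the desired map is
    its inverse.\<close>
  let ?\<phi> = "inv_into (central_barred_perms n) ?\<psi>"
  note bij = bij_betw_graph_of_barred_perm[OF assms]
  show \<phi>: "bij_betw ?\<phi> (threshold_graphs n) (central_barred_perms n)"
    using bij_betw_inv_into[OF bij] .
  fix G u v
  assume G: "G \<in> threshold_graphs n" and uv: "u \<in> {1..n}" "v \<in> {1..n}"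
    and deg: "degree G u = degree G v"
  have p: "?\<phi> G \<in> central_barred_perms n" by (rule bspec[OF bij_betwE[OF \<phi>] G])
  have "?\<psi> (?\<phi> G) = G" using bij_betw_inv_into_right[OF bij G] .
  then have "block_index (?\<phi> G) u = block_index (?\<phi> G) v"
    using level_graph_equal_degree[OF _ central_barred_permsD(3)[OF p] uv] deg
    by (simp add: graph_of_barred_perm_def)
  then show "same_block n (?\<phi> G) u v"
    using uv by (simp add: same_block_iff[OF central_barred_permsD(1)[OF p]])
qed

end
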